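(* Let $M\ge 1$, let $\lambda>0$, let $\pi_1,\dots,\pi_M$ be the sampling probabilities, and suppose that the real data density $P_{data}^d$ of the dataset $X_d$ can be written in the form $$P_{data}^d(x)=\sum_{m=1}^{M}\pi_m\, p_d^m(x),$$ where $p_d^1,\dots,p_d^M$ are probability densities such that, for any given $x$, if $p_d^m(x)>0$ for some $m\in\{1,\dots,M\}$, then $p_d^{m'}(x)=0$ for all $m'\neq m$. Then, at the equilibrium point of the minimax game $$\min_{\boldsymbol G_d,\,C_d}\ \max_{D_d}\ \ \mathbb{E}_{x\sim P_{data}^d}[\log D_d(x)]+\sum_{m=1}^M \pi_m\,\mathbb{E}_{z\sim P_z}\big[\log\big(1-D_d(G_d^m(z))\big)\big]-\lambda\sum_{m=1}^M\pi_m\,\mathbb{E}_{\hat x\sim P_{G_d^m}}\big[\log C_d^m(\hat x)\big],$$ the optimal classifier $C_d^*=({C_d^1}^*,\dots,{C_d^M}^* )$ and the optimal generators, with densities $P_{G_d^1}^*,\dots,P_{G_d^M}^*$, satisfy: (a) for every $m\in\{1,\dots,M\}$, ${C_d^m}^*(x)=1$ if $x\sim P_{G_d^m}^*$, and ${C_d^m}^*(x)=0$ if $x\sim P_{G_d^{m'}}^*$ for some $m'\ne m$ (that is, for almost every $x$ with respect to the indicated distribution); (b) $P_{G_d^m}^*(x)=p_d^m(x)$ for all $m=1,\dots,M$; (c) $P_{model}^d(x)=P_{data}^d(x)$, where $P_{model}^d=\sum_{m=1}^M\pi_m P_{G_d^m}^*$.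
   Context: Fix an index $d$ of a local dataset $X_d$, whose real data distribution has probability density $P_{data}^d$ on the sample space. There are $M$ generators $\boldsymbol G_d=\{G_d^1,\dots,G_d^M\}$; generator $G_d^m$ maps noise $z\sim P_z$ to a synthetic sample $G_d^m(z)$, and $P_{G_d^m}$ denotes the probability density of $G_d^m(z)$. The sampling probabilities (mixture weights) $\pi_1,\dots,\pi_M$ are fixed, nonnegative and sum to $1$; the combined synthetic data have density $P_{model}^d(x)=\sum_{m=1}^M\pi_m P_{G_d^m}(x)$. The discriminator $D_d$ is a function from the sample space to $[0,1]$ ($D_d(x)$ is the probability assigned to $x$ being real). The classifier is $C_d=(C_d^1,\dots,C_d^M)$ with $C_d^m(x)\ge 0$ and $\sum_{m=1}^M C_d^m(x)=1$ ($C_d^m(x)$ is the probability assigned to $x$ being generated by $G_d^m$). The analysis is non-parametric: $D_d$ and $C_d$ range over all measurable functions of this kind and the generators may realize arbitrary probability densities. Densities are identified when equal almost everywhere. The equilibrium point of the minimax game is a triple $(\boldsymbol G_d^*,C_d^*,D_d^* )$ solving the $\min_{\boldsymbol G_d,C_d}\max_{D_d}$ problem: $D_d^*$ attains the inner maximum for $(\boldsymbol G_d^*,C_d^* )$, and $(\boldsymbol G_d^*,C_d^* )$ minimizes the value of the inner maximum.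
   Formalization: Proved: every equilibrium has (c), (a) on generators of positive weight, and for these (b) for some separated decomposition, or for the given p_d^m if C_d^* labels them correctly; some equilibrium has (a)-(c) in full. Label swaps and zero weights refute the literal claim. *)

theory Defs
  imports "HOL-Probability.Probability"
begin

text \<open>
  Conventions: \<open>S\<close> is the sample space with its reference measure, \<open>N\<close> the law of the noise,
  \<open>w m\<close> the sampling probability of generator \<open>m\<close>, and \<open>P\<close> the real data density.
  Families of generators, classifier components and weights are functions on \<open>nat\<close> of which only
  the values at \<open>1, \<dots>, M\<close> matter.
\<close>

definition prob_density :: "'x measure \<Rightarrow> ('x \<Rightarrow> real) \<Rightarrow> bool" where
  "prob_density S f \<longleftrightarrow>
     f \<in> borel_measurable S \<and> (\<forall>x\<in>space S. 0 \<le> f x) \<and> (\<integral>\<^sup>+x. ennreal (f x) \<partial>S) = 1"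

text \<open>The logarithm with \<open>log 0 = -\<infinity>\<close>; the library's \<^const>\<open>ln\<close> on \<^typ>\<open>real\<close> has \<open>ln 0 = 0\<close>,
  which would remove the penalty for assigning probability zero.\<close>

definition elog :: "real \<Rightarrow> ereal" where
  "elog t = (if t \<le> 0 then -\<infinity> else ereal (ln t))"

text \<open>Extended expectation, the difference of the integrals of the positive and the negative part.
  It is only applied to functions of constant sign.\<close>

definition ext_expectation :: "'a measure \<Rightarrow> ('a \<Rightarrow> ereal) \<Rightarrow> ereal" where
  "ext_expectation Q f =
     enn2ereal (\<integral>\<^sup>+x. e2ennreal (f x) \<partial>Q) - enn2ereal (\<integral>\<^sup>+x. e2ennreal (- f x) \<partial>Q)"

definition generators :: "'x measure \<Rightarrow> 'z measure \<Rightarrow> nat \<Rightarrow> (nat \<Rightarrow> 'z \<Rightarrow> 'x) set" where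
  "generators S N M = {G. \<forall>m\<in>{1..M}. \<exists>f. prob_density S f \<and> distributed N S (G m) (\<lambda>x. ennreal (f x))}"

definition classifiers :: "'x measure \<Rightarrow> nat \<Rightarrow> (nat \<Rightarrow> 'x \<Rightarrow> real) set" where
  "classifiers S M =
     {C. (\<forall>m\<in>{1..M}. C m \<in> borel_measurable S \<and> (\<forall>x\<in>space S. 0 \<le> C m x)) \<and>
         (\<forall>x\<in>space S. (\<Sum>m=1..M. C m x) = 1)}"

definition discriminators :: "'x measure \<Rightarrow> ('x \<Rightarrow> real) set" where
  "discriminators S = {D. D \<in> borel_measurable S \<and> (\<forall>x\<in>space S. 0 \<le> D x \<and> D x \<le> 1)}"

text \<open>The first two summands lie in \<open>[-\<infinity>, 0]\<close> and the subtracted term as well. Relevant conventions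
  of \<^typ>\<open>ereal\<close>: \<open>0 * (-\<infinity>) = 0\<close>, so components of weight zero do not contribute, and
  \<open>(-\<infinity>) - (-\<infinity>) = \<infinity>\<close>. The latter does not influence the supremum over the discriminators: if the
  classifier term is infinite, the constant discriminator \<open>1/2\<close> already gives the value \<open>\<infinity>\<close>.\<close>

definition objective :: "'x measure \<Rightarrow> 'z measure \<Rightarrow> nat \<Rightarrow> (nat \<Rightarrow> real) \<Rightarrow> real \<Rightarrow> ('x \<Rightarrow> real) \<Rightarrow>
    (nat \<Rightarrow> 'z \<Rightarrow> 'x) \<Rightarrow> (nat \<Rightarrow> 'x \<Rightarrow> real) \<Rightarrow> ('x \<Rightarrow> real) \<Rightarrow> ereal" where
  "objective S N M w lam P G C D =
     ext_expectation (density S (\<lambda>x. ennreal (P x))) (\<lambda>x. elog (D x))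
     + (\<Sum>m=1..M. ereal (w m) * ext_expectation N (\<lambda>z. elog (1 - D (G m z))))
     - ereal lam * (\<Sum>m=1..M. ereal (w m) * ext_expectation (distr N S (G m)) (\<lambda>x. elog (C m x)))"

definition inner_max :: "'x measure \<Rightarrow> 'z measure \<Rightarrow> nat \<Rightarrow> (nat \<Rightarrow> real) \<Rightarrow> real \<Rightarrow> ('x \<Rightarrow> real) \<Rightarrow>
    (nat \<Rightarrow> 'z \<Rightarrow> 'x) \<Rightarrow> (nat \<Rightarrow> 'x \<Rightarrow> real) \<Rightarrow> ereal" where
  "inner_max S N M w lam P G C = (SUP D\<in>discriminators S. objective S N M w lam P G C D)"

definition equilibrium :: "'x measure \<Rightarrow> 'z measure \<Rightarrow> nat \<Rightarrow> (nat \<Rightarrow> real) \<Rightarrow> real \<Rightarrow> ('x \<Rightarrow> real) \<Rightarrow>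
    (nat \<Rightarrow> 'z \<Rightarrow> 'x) \<Rightarrow> (nat \<Rightarrow> 'x \<Rightarrow> real) \<Rightarrow> ('x \<Rightarrow> real) \<Rightarrow> bool" where
  "equilibrium S N M w lam P G C D \<longleftrightarrow>
     G \<in> generators S N M \<and> C \<in> classifiers S M \<and> D \<in> discriminators S \<and>
     objective S N M w lam P G C D = inner_max S N M w lam P G C \<and>
     (\<forall>G'\<in>generators S N M. \<forall>C'\<in>classifiers S M.
        inner_max S N M w lam P G C \<le> inner_max S N M w lam P G' C')"

text \<open>The density of \<open>g(z)\<close>, \<open>z \<sim> N\<close>. The Radon-Nikodym derivative is a density because
  members of \<^const>\<open>generators\<close> have absolutely continuous laws, and it is finite almost everywhere.\<close>

definition gen_density :: "'x measure \<Rightarrow> 'z measure \<Rightarrow> ('z \<Rightarrow> 'x) \<Rightarrow> 'x \<Rightarrow> real" where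
  "gen_density S N g x = enn2real (RN_deriv S (distr N S g) x)"

definition model_density :: "'x measure \<Rightarrow> 'z measure \<Rightarrow> nat \<Rightarrow> (nat \<Rightarrow> real) \<Rightarrow>
    (nat \<Rightarrow> 'z \<Rightarrow> 'x) \<Rightarrow> 'x \<Rightarrow> real" where
  "model_density S N M w G x = (\<Sum>m=1..M. w m * gen_density S N (G m) x)"

definition separated_mixture :: "'x measure \<Rightarrow> nat \<Rightarrow> (nat \<Rightarrow> real) \<Rightarrow> ('x \<Rightarrow> real) \<Rightarrow>
    (nat \<Rightarrow> 'x \<Rightarrow> real) \<Rightarrow> bool" where
  "separated_mixture S M w P p \<longleftrightarrow>
     (\<forall>m\<in>{1..M}. prob_density S (p m)) \<and>
     (AE x in S. P x = (\<Sum>m=1..M. w m * p m x)) \<and>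
     (\<forall>x\<in>space S. \<forall>m\<in>{1..M}. p m x > 0 \<longrightarrow> (\<forall>m'\<in>{1..M}. m' \<noteq> m \<longrightarrow> p m' x = 0))"

end

theory Submission
  imports Defs
begin

text \<open>
  In terms of \<open>-log\<close> the value of the game is a classifier loss minus a discriminator loss. If
  \<open>P_model = P_data\<close>, the discriminator loss is at least \<open>2 log 2\<close>, because \<open>t (1 - t) \<le> 1/4\<close>, with
  equality for \<open>D = 1/2\<close>. If \<open>P_model \<noteq> P_data\<close>, some \<open>D\<close> makes it smaller than \<open>2 log 2\<close>. The classifier
  loss is nonnegative, and zero exactly if \<open>C m = 1\<close> almost surely under generator \<open>m\<close>. Since the real
  data split into components with disjoint supports, both optima are attained together, so every
  equilibrium has value \<open>-2 log 2\<close> and attains both.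
\<close>

section \<open>The negative logarithm\<close>

text \<open>Values in \<open>ennreal\<close> make every loss a nonnegative integral that needs no
  integrability condition. Above \<open>1\<close>, where the negative logarithm is negative, the
  value is cut off at \<open>0\<close>.\<close>

definition neg_log :: "real \<Rightarrow> ennreal" where
  "neg_log t = e2ennreal (- elog t)"

lemma neg_log_pos: "0 < t \<Longrightarrow> neg_log t = ennreal (- ln t)"
  by (simp add: neg_log_def elog_def ennreal_def e2ennreal_def)

lemma neg_log_nonpos: "t \<le> 0 \<Longrightarrow> neg_log t = \<infinity>"
  by (simp add: neg_log_def elog_def)

lemma neg_log_measurable [measurable]: "neg_log \<in> borel_measurable borel"
proof -
  have eq: "neg_log = (\<lambda>t. if t \<le> 0 then \<infinity> else ennreal (- ln t))"
    by (auto simp: neg_log_pos neg_log_nonpos)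
  show ?thesis unfolding eq by measurable
qed

lemma neg_log_eq_0_iff: "neg_log t = 0 \<longleftrightarrow> 1 \<le> t"
proof (cases "t \<le> 0")
  case False
  then show ?thesis by (simp add: neg_log_pos ennreal_eq_0_iff)
qed (simp add: neg_log_nonpos)

text \<open>Between the end points this is the logarithm of
  \<open>4 * t * (1 - t) = 1 - (2 * t - 1)^2 \<le> 1\<close>; at the end points one summand is
  infinite.\<close>

lemma neg_log_add_ge:
  assumes "0 \<le> t" "t \<le> 1"
  shows "ennreal (2 * ln 2) \<le> neg_log t + neg_log (1 - t)"
proof (cases "0 < t \<and> t < 1")
  case True
  have "4 * (t * (1 - t)) \<le> 1"
    using sum_squares_ge_zero [of "2 * t - 1" 0] by (simp add: algebra_simps)
  then have "ln (4 * (t * (1 - t))) \<le> 0"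
    using True by simp
  moreover have "ln (4 * (t * (1 - t))) = ln (2^2) + (ln t + ln (1 - t))"
    using True by (simp add: ln_mult)
  ultimately have "2 * ln 2 \<le> - ln t + - ln (1 - t)"
    by (simp only: ln_realpow)
  moreover have "neg_log t + neg_log (1 - t) = ennreal (- ln t + - ln (1 - t))"
    using True by (simp add: neg_log_pos ennreal_plus [symmetric] del: ennreal_plus)
  ultimately show ?thesis
    by (simp add: ennreal_leI)
next
  case False
  then have "t = 0 \<or> t = 1" using assms by auto
  then show ?thesis by (auto simp: neg_log_nonpos)
qed

lemma elog_le_0: "t \<le> 1 \<Longrightarrow> elog t \<le> 0"
  by (simp add: elog_def)

section \<open>Extended expectations as nonnegative integrals\<close>

text \<open>Since \<open>elog (h x) \<le> 0\<close>, the positive part integrates to zero and only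
  the negative part is left.\<close>

lemma ext_expectation_elog:
  assumes "\<And>x. x \<in> space Q \<Longrightarrow> h x \<le> 1"
  shows "ext_expectation Q (\<lambda>x. elog (h x)) = - enn2ereal (\<integral>\<^sup>+x. neg_log (h x) \<partial>Q)"
proof -
  have "(\<integral>\<^sup>+x. e2ennreal (elog (h x)) \<partial>Q) = (\<integral>\<^sup>+x. 0 \<partial>Q)"
    using assms by (intro nn_integral_cong) (simp add: e2ennreal_neg elog_le_0)
  then show ?thesis
    by (simp add: ext_expectation_def neg_log_def zero_ennreal.rep_eq)
qed

text \<open>Negation in \<open>ereal\<close> distributes over a sum only if no opposite infinities
  meet; here all summands have the same sign.\<close>

lemma sum_weighted_uminus_enn2ereal:
  assumes "\<And>m. m \<in> A \<Longrightarrow> 0 \<le> w m"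
  shows "(\<Sum>m\<in>A. ereal (w m) * - enn2ereal (I m)) = - enn2ereal (\<Sum>m\<in>A. ennreal (w m) * I m)"
  using assms
proof (induction A rule: infinite_finite_induct)
  case (insert a A)
  have "enn2ereal (ennreal (w a) * I a) = ereal (w a) * enn2ereal (I a)"
    using insert.prems by (simp add: times_ennreal.rep_eq enn2ereal_ennreal)
  moreover have "- (x + y) = - x + - y" if "0 \<le> x" "0 \<le> y" for x y :: ereal
    using that by (cases x; cases y) auto
  ultimately show ?case
    using insert by (simp add: plus_ennreal.rep_eq)
qed (simp_all add: zero_ennreal.rep_eq)

lemma uminus_le_ereal_uminus_iff: "- x \<le> ereal (- r) \<longleftrightarrow> ereal r \<le> x"
  by (cases x) auto

section \<open>Discriminators that beat the constant \<open>1 / 2\<close>\<close>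

text \<open>\<open>t\<close> is the midpoint of \<open>1/2\<close> and the optimal response \<open>a / (a + b)\<close>; unlike the latter it stays
  away from \<open>0\<close> and \<open>1\<close>, so that all logarithms are finite. For \<open>a = b = 0\<close> it is \<open>1/2\<close>.\<close>

lemma midpoint_response_gain:
  fixes a b :: real
  assumes "0 \<le> a" "0 \<le> b"
  defines "t \<equiv> 1 / 2 + (a - b) / (4 * (a + b))"
  shows "1 / 4 \<le> t" "t \<le> 3 / 4"
    and "0 \<le> a * ln (2 * t) + b * ln (2 * (1 - t))"
    and "a * ln (2 * t) + b * ln (2 * (1 - t)) = 0 \<Longrightarrow> a = b"
proof -
  show t: "1 / 4 \<le> t" "t \<le> 3 / 4"
    using assms by (cases "a + b = 0"; simp add: t_def field_simps)+
  \<comment> \<open>This is \<open>ln u \<le> u - 1\<close> at \<open>u = 1 / s\<close>. It bounds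
    the gain below by a rational function that turns out to be a nonnegative multiple of
    \<open>(a - b)^2\<close>.\<close>
  have ln_ge: "1 - 1 / s \<le> ln s" if "0 < s" for s :: real
    using ln_le_minus_one [of "1 / s"] that by (simp add: ln_div)
  have "a * (1 - 1 / (2 * t)) + b * (1 - 1 / (2 * (1 - t))) \<le> a * ln (2 * t) + b * ln (2 * (1 - t))"
    using t assms(1,2) by (intro add_mono mult_left_mono ln_ge) auto
  moreover have "a * (1 - 1 / (2 * t)) + b * (1 - 1 / (2 * (1 - t)))
      = (2 * t - 1) * (a - (a + b) * t) / (2 * t * (1 - t))"
    using t assms(1,2) by (simp add: divide_simps) (simp add: algebra_simps)
  moreover have "(2 * t - 1) * (a - (a + b) * t) = (a - b)\<^sup>2 / (8 * (a + b))"
  \<comment> \<open>For \<open>a + b = 0\<close> the convention \<open>x / 0 = 0\<close> gives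
    \<open>t = 1 / 2\<close>, and both sides are \<open>0\<close>.\<close>
  proof (cases "a + b = 0")
    case False
    then have "a - (a + b) * t = (a - b) / 4"
      by (simp add: t_def field_simps)
    moreover have "2 * t - 1 = (a - b) / (2 * (a + b))"
      using False by (simp add: t_def divide_simps) (simp add: algebra_simps)
    ultimately show ?thesis
      by (simp only: times_divide_times_eq power2_eq_square)
  qed (use assms in \<open>simp add: t_def\<close>)
  ultimately have low: "(a - b)\<^sup>2 / (8 * (a + b)) / (2 * t * (1 - t)) \<le> a * ln (2 * t) + b * ln (2 * (1 - t))"
    by simp
  have pos: "0 < 2 * t * (1 - t)" using t by simp
  have "0 \<le> (a - b)\<^sup>2 / (8 * (a + b)) / (2 * t * (1 - t))"
    using pos assms by (intro divide_nonneg_pos divide_nonneg_nonneg) auto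
  with low show "0 \<le> a * ln (2 * t) + b * ln (2 * (1 - t))" by linarith
  show "a = b" if "a * ln (2 * t) + b * ln (2 * (1 - t)) = 0"
  proof (rule ccontr)
    assume "a \<noteq> b"
    then have "0 < (a - b)\<^sup>2 / (8 * (a + b)) / (2 * t * (1 - t))"
      using pos assms by (intro divide_pos_pos) auto
    with low that show False by linarith
  qed
qed

text \<open>For the midpoint response \<open>D\<close>, the loss and the integral of its pointwise
  gain \<open>k\<close> over the constant \<open>1 / 2\<close> add up to \<open>2 * ln 2\<close>.
  The assumed bound leaves no room for a gain, so \<open>k\<close> vanishes almost everywhere, which
  forces \<open>P = Q\<close>.\<close>

lemma AE_eq_of_loss_ge:
  fixes P Q :: "'x \<Rightarrow> real"
  assumes P: "prob_density S P" and Q: "prob_density S Q"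
    and loss: "\<And>D. D \<in> discriminators S \<Longrightarrow>
      ennreal (2 * ln 2) \<le> (\<integral>\<^sup>+x. neg_log (D x) * ennreal (P x) + neg_log (1 - D x) * ennreal (Q x) \<partial>S)"
  shows "AE x in S. Q x = P x"
proof -
  have [measurable]: "P \<in> borel_measurable S" "Q \<in> borel_measurable S"
    using P Q by (auto simp: prob_density_def)
  have nn: "0 \<le> P x" "0 \<le> Q x" if "x \<in> space S" for x
    using P Q that by (auto simp: prob_density_def)
  define D where "D x = 1 / 2 + (P x - Q x) / (4 * (P x + Q x))" for x
  define k where "k x = P x * ln (2 * D x) + Q x * ln (2 * (1 - D x))" for x
  have gap: "1 / 4 \<le> D x" "D x \<le> 3 / 4" "0 \<le> k x" "k x = 0 \<longrightarrow> P x = Q x" if "x \<in> space S" for x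
    using midpoint_response_gain [OF nn [OF that]] unfolding D_def k_def by blast+
  have [measurable]: "D \<in> borel_measurable S"
    unfolding D_def by measurable
  have [measurable]: "k \<in> borel_measurable S"
    unfolding k_def by measurable
  have "0 \<le> D x \<and> D x \<le> 1" if "x \<in> space S" for x
    using gap(1,2) [OF that] by linarith
  then have D: "D \<in> discriminators S"
    by (simp add: discriminators_def)
  let ?h = "\<lambda>x. neg_log (D x) * ennreal (P x) + neg_log (1 - D x) * ennreal (Q x)"
  \<comment> \<open>Putting the gain on the side of the loss avoids truncated subtraction in
    \<open>ennreal\<close>.\<close>
  have split: "?h x + ennreal (k x) = ennreal (ln 2) * (ennreal (P x) + ennreal (Q x))"
    if x: "x \<in> space S" for x
  proof -
    have "?h x = ennreal (- ln (D x) * P x + - ln (1 - D x) * Q x)"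
      using gap(1,2) [OF x] nn [OF x]
      by (simp add: neg_log_pos ennreal_mult' [symmetric] ennreal_plus [symmetric] mult_nonpos_nonneg
          del: ennreal_plus)
    moreover have "0 \<le> - ln (D x) * P x + - ln (1 - D x) * Q x"
      using gap(1,2) [OF x] nn [OF x] by (intro add_nonneg_nonneg mult_nonneg_nonneg) auto
    moreover have "- ln (D x) * P x + - ln (1 - D x) * Q x + k x = ln 2 * (P x + Q x)"
    proof -
      have "ln (2 * D x) = ln 2 + ln (D x)" "ln (2 * (1 - D x)) = ln 2 + ln (1 - D x)"
        using gap(1,2) [OF x] by (subst ln_mult; simp)+
      then show ?thesis by (simp add: k_def algebra_simps)
    qed
    ultimately show ?thesis
      using gap(3) [OF x] nn [OF x]
      by (simp add: ennreal_plus [symmetric] ennreal_mult [symmetric] del: ennreal_plus)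
  qed
  have "(\<integral>\<^sup>+x. ?h x \<partial>S) + (\<integral>\<^sup>+x. ennreal (k x) \<partial>S)
      = (\<integral>\<^sup>+x. ennreal (ln 2) * (ennreal (P x) + ennreal (Q x)) \<partial>S)"
    by (subst nn_integral_add [symmetric]) (auto intro!: nn_integral_cong split)
  also have "\<dots> = ennreal (ln 2) * 2"
    using P Q by (subst nn_integral_cmult) (auto simp: nn_integral_add prob_density_def)
  also have "\<dots> = ennreal (2 * ln 2)"
    by (simp add: ennreal_mult mult.commute)
  finally have sum: "(\<integral>\<^sup>+x. ?h x \<partial>S) + (\<integral>\<^sup>+x. ennreal (k x) \<partial>S) = ennreal (2 * ln 2)" .
  have "(\<integral>\<^sup>+x. ennreal (k x) \<partial>S) = 0"
  proof -
    \<comment> \<open>Cancellation in \<open>ennreal\<close> requires a finite summand;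
      \<open>a\<close> is squeezed to the finite value \<open>ennreal r\<close>.\<close>
    have "c = 0" if "a + c = ennreal r" "ennreal r \<le> a" for a c r
    proof -
      have "a \<le> a + c" by simp
      then have "a = ennreal r" using that by simp
      then have "a + c = a + 0" using that by simp
      then show ?thesis using \<open>a = ennreal r\<close> by (simp only: ennreal_add_left_cancel) simp
    qed
    then show ?thesis using sum loss [OF D] by blast
  qed
  then have "AE x in S. ennreal (k x) = 0"
    by (subst (asm) nn_integral_0_iff_AE) auto
  then show ?thesis
  proof (rule AE_mp, intro AE_I2 impI)
    fix x assume x: "x \<in> space S" "ennreal (k x) = 0"
    then have "k x = 0"
      using gap(3) [of x] by (simp add: ennreal_eq_0_iff)
    then show "Q x = P x"
      using gap(4) [of x] x by simp
  qed
qed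


section \<open>Mixtures and densities of generators\<close>

definition mixture :: "nat \<Rightarrow> (nat \<Rightarrow> real) \<Rightarrow> (nat \<Rightarrow> 'x \<Rightarrow> real) \<Rightarrow> 'x \<Rightarrow> real" where
  "mixture M w f x = (\<Sum>m=1..M. w m * f m x)"

text \<open>With \<open>h = 1\<close> this gives the total mass of a mixture; with the loss
  \<open>neg_log (1 - D x)\<close> it merges the generator terms of the objective into one
  integral.\<close>

lemma nn_integral_mixture:
  assumes "\<And>m. m \<in> {1..M} \<Longrightarrow> 0 \<le> w m" and "\<And>m. m \<in> {1..M} \<Longrightarrow> prob_density S (f m)"
    and [measurable]: "h \<in> borel_measurable S"
  shows "(\<integral>\<^sup>+x. h x * ennreal (mixture M w f x) \<partial>S)
    = (\<Sum>m=1..M. ennreal (w m) * (\<integral>\<^sup>+x. ennreal (f m x) * h x \<partial>S))"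
proof -
  have [measurable]: "f m \<in> borel_measurable S" if "m \<in> {1..M}" for m
    using assms(2) that by (simp add: prob_density_def)
  have "h x * ennreal (mixture M w f x) = (\<Sum>m=1..M. ennreal (w m) * (ennreal (f m x) * h x))"
    if "x \<in> space S" for x
  proof -
    have nn: "0 \<le> w m" "0 \<le> f m x" if "m \<in> {1..M}" for m
      using assms(1,2) that \<open>x \<in> space S\<close> by (auto simp: prob_density_def)
    have "ennreal (mixture M w f x) = (\<Sum>m=1..M. ennreal (w m) * ennreal (f m x))"
      unfolding mixture_def using nn
      by (subst sum_ennreal [symmetric]) (auto simp: ennreal_mult intro!: sum.cong)
    then show ?thesis
      by (simp add: sum_distrib_left mult_ac)
  qed
  then have "(\<integral>\<^sup>+x. h x * ennreal (mixture M w f x) \<partial>S)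
      = (\<integral>\<^sup>+x. (\<Sum>m=1..M. ennreal (w m) * (ennreal (f m x) * h x)) \<partial>S)"
    by (rule nn_integral_cong)
  also have "\<dots> = (\<Sum>m=1..M. \<integral>\<^sup>+x. ennreal (w m) * (ennreal (f m x) * h x) \<partial>S)"
    by (rule nn_integral_sum) measurable
  also have "\<dots> = (\<Sum>m=1..M. ennreal (w m) * (\<integral>\<^sup>+x. ennreal (f m x) * h x \<partial>S))"
    by (intro sum.cong refl nn_integral_cmult) measurable
  finally show ?thesis .
qed

lemma prob_density_mixture:
  assumes "\<And>m. m \<in> {1..M} \<Longrightarrow> 0 \<le> w m" and "(\<Sum>m=1..M. w m) = 1"
    and "\<And>m. m \<in> {1..M} \<Longrightarrow> prob_density S (f m)"
  shows "prob_density S (mixture M w f)"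
proof -
  have "(\<integral>\<^sup>+x. ennreal (mixture M w f x) \<partial>S) = (\<Sum>m=1..M. ennreal (w m))"
    using nn_integral_mixture [where h = "\<lambda>_. 1", OF assms(1,3)] assms(3)
    by (simp add: prob_density_def)
  also have "\<dots> = 1"
    using assms(1,2) by (subst sum_ennreal) auto
  finally show ?thesis
    using assms unfolding prob_density_def mixture_def
    by (auto intro!: sum_nonneg borel_measurable_sum borel_measurable_times)
qed

text \<open>Radon-Nikodym derivatives over a sigma-finite measure are unique almost everywhere, and
  \<open>enn2real\<close> undoes \<open>ennreal\<close> because \<open>f\<close> is
  nonnegative.\<close>

lemma (in sigma_finite_measure) gen_density_eq:
  assumes "distributed N M g (\<lambda>x. ennreal (f x))" and "prob_density M f"
  shows "AE x in M. gen_density M N g x = f x"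
proof -
  have "AE x in M. ennreal (f x) = RN_deriv M (distr N M g) x"
    using assms by (intro RN_deriv_unique) (auto simp: distributed_def)
  then show ?thesis
  proof (rule AE_mp, intro AE_I2 impI)
    fix x assume "x \<in> space M" "ennreal (f x) = RN_deriv M (distr N M g) x"
    then show "gen_density M N g x = f x"
      using assms(2) by (simp add: gen_density_def prob_density_def flip: \<open>ennreal (f x) = _\<close>)
  qed
qed

section \<open>The game and its two losses\<close>

locale gan_game =
  fixes S :: "'x measure" and N :: "'z measure" and M :: nat
    and w :: "nat \<Rightarrow> real" and lam :: real and P :: "'x \<Rightarrow> real"
  assumes sigma_finite_S: "sigma_finite_measure S"
    and lam_pos: "lam > 0"
    and w_nonneg: "\<And>m. m \<in> {1..M} \<Longrightarrow> w m \<ge> 0" and w_sum: "(\<Sum>m=1..M. w m) = 1"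
    and P: "prob_density S P"
begin

text \<open>Explicit densities that are nonnegative everywhere are carried along in place of
  \<open>gen_density\<close>, whose values on null sets carry no information.\<close>

definition realizes :: "(nat \<Rightarrow> 'x \<Rightarrow> real) \<Rightarrow> (nat \<Rightarrow> 'z \<Rightarrow> 'x) \<Rightarrow> bool" where
  "realizes f G \<longleftrightarrow>
     (\<forall>m\<in>{1..M}. prob_density S (f m) \<and> distributed N S (G m) (\<lambda>x. ennreal (f m x)))"

text \<open>The binary cross-entropy of \<open>D\<close>, with \<open>Q\<close> in the place of the
  model density. A single integral allows pointwise comparison of both parts.\<close>

definition discriminator_loss :: "('x \<Rightarrow> real) \<Rightarrow> ('x \<Rightarrow> real) \<Rightarrow> ennreal" where
  "discriminator_loss Q D =
     (\<integral>\<^sup>+x. neg_log (D x) * ennreal (P x) + neg_log (1 - D x) * ennreal (Q x) \<partial>S)"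

definition classifier_loss :: "(nat \<Rightarrow> 'z \<Rightarrow> 'x) \<Rightarrow> (nat \<Rightarrow> 'x \<Rightarrow> real) \<Rightarrow> ennreal" where
  "classifier_loss G C = (\<Sum>m=1..M. ennreal (w m) * (\<integral>\<^sup>+x. neg_log (C m x) \<partial>distr N S (G m)))"

lemma P_measurable [measurable]: "P \<in> borel_measurable S"
  using P by (auto simp: prob_density_def)

lemma realizesD:
  assumes "realizes f G" "m \<in> {1..M}"
  shows "prob_density S (f m)" "distr N S (G m) = density S (\<lambda>x. ennreal (f m x))"
    "G m \<in> measurable N S" "f m \<in> borel_measurable S" "x \<in> space S \<Longrightarrow> 0 \<le> f m x"
  using assms by (auto simp: realizes_def distributed_def prob_density_def)

lemma generators_realizes: "G \<in> generators S N M \<longleftrightarrow> (\<exists>f. realizes f G)"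
  unfolding generators_def realizes_def mem_Collect_eq by (rule bchoice_iff)

lemma prob_density_realized: "realizes f G \<Longrightarrow> prob_density S (mixture M w f)"
  using w_nonneg w_sum realizesD(1) by (intro prob_density_mixture)

lemma classifier_le_1:
  assumes "C \<in> classifiers S M" "m \<in> {1..M}" "x \<in> space S"
  shows "C m x \<le> 1"
proof -
  have "C m x \<le> (\<Sum>m=1..M. C m x)"
    using assms by (intro member_le_sum) (auto simp: classifiers_def)
  then show ?thesis using assms by (simp add: classifiers_def)
qed

text \<open>Two nonnegative components cannot exceed one together. So the sets where different
  components equal one are disjoint, which is how the classifier separates the generators.\<close>

lemma classifier_other_eq_0:
  assumes C: "C \<in> classifiers S M" and "m \<in> {1..M}" "m' \<in> {1..M}" "m' \<noteq> m"
    and x: "x \<in> space S" and "C m x = 1"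
  shows "C m' x = 0"
proof -
  have "(\<Sum>i\<in>{m, m'}. C i x) \<le> (\<Sum>i=1..M. C i x)"
    using assms by (intro sum_mono2) (auto simp: classifiers_def)
  then have "C m x + C m' x \<le> 1" "0 \<le> C m' x"
    using assms by (simp_all add: classifiers_def)
  then show ?thesis using \<open>C m x = 1\<close> by linarith
qed

text \<open>Moves statements about different generators to the common measure \<open>S\<close>,
  where they can be combined.\<close>

lemma AE_realized_iff:
  assumes "realizes f G" "m \<in> {1..M}"
  shows "(AE x in distr N S (G m). R x) \<longleftrightarrow> (AE x in S. f m x > 0 \<longrightarrow> R x)"
  unfolding realizesD(2) [OF assms] using realizesD(4) [OF assms] by (simp add: AE_density)

lemma mixture_pos_iff:
  assumes "\<And>m. m \<in> {1..M} \<Longrightarrow> 0 \<le> f m x"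
  shows "mixture M w f x > 0 \<longleftrightarrow> (\<exists>m\<in>{1..M}. w m > 0 \<and> f m x > 0)"
proof
  assume "mixture M w f x > 0"
  then obtain m where "m \<in> {1..M}" "w m * f m x > 0"
    unfolding mixture_def by (meson not_less sum_nonpos)
  then show "\<exists>m\<in>{1..M}. w m > 0 \<and> f m x > 0"
    using w_nonneg [of m] assms [of m] by (auto simp: zero_less_mult_iff)
next
  assume "\<exists>m\<in>{1..M}. w m > 0 \<and> f m x > 0"
  then obtain m where m: "m \<in> {1..M}" "w m > 0" "f m x > 0"
    by blast
  show "mixture M w f x > 0"
    unfolding mixture_def
  proof (rule sum_pos2 [OF _ m(1)])
    show "0 < w m * f m x" using m by simp
    show "0 \<le> w i * f i x" if "i \<in> {1..M}" for i
      using w_nonneg assms that by simp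
  qed simp
qed

lemma mixture_cong:
  assumes "\<And>m. m \<in> {1..M} \<Longrightarrow> w m > 0 \<Longrightarrow> f m x = g m x"
  shows "mixture M w f x = mixture M w g x"
  unfolding mixture_def
proof (rule sum.cong [OF refl])
  fix m assume "m \<in> {1..M}"
  then show "w m * f m x = w m * g m x"
    using w_nonneg [of m] assms [of m] by (cases "w m = 0") auto
qed

lemma mixture_single:
  assumes "m \<in> {1..M}" "\<And>m'. m' \<in> {1..M} \<Longrightarrow> m' \<noteq> m \<Longrightarrow> w m' > 0 \<Longrightarrow> f m' x = 0"
  shows "mixture M w f x = w m * f m x"
proof -
  have "mixture M w f x = mixture M w (\<lambda>i x. if i = m then f m x else 0) x"
    using assms(2) by (intro mixture_cong) auto
  also have "\<dots> = w m * f m x"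
    using assms(1) by (simp add: mixture_def if_distrib cong: if_cong)
  finally show ?thesis .
qed

section \<open>The objective and its inner maximum\<close>

text \<open>All logarithms are taken of numbers at most one, so each term is, up to its sign, a
  nonnegative integral. The change of variables along \<open>G m\<close> turns the noise
  expectations into integrals against the mixture.\<close>

lemma objective_eq:
  assumes G: "realizes f G" and C: "C \<in> classifiers S M" and D: "D \<in> discriminators S"
  shows "objective S N M w lam P G C D
    = enn2ereal (ennreal lam * classifier_loss G C) - enn2ereal (discriminator_loss (mixture M w f) D)"
proof -
  have [measurable]: "D \<in> borel_measurable S" "mixture M w f \<in> borel_measurable S"
    using D prob_density_realized [OF G] by (auto simp: discriminators_def prob_density_def)
  have Dx: "0 \<le> D x" "D x \<le> 1" if "x \<in> space S" for x
    using D that by (auto simp: discriminators_def)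
  let ?A = "\<integral>\<^sup>+x. neg_log (D x) * ennreal (P x) \<partial>S"
  let ?B = "\<integral>\<^sup>+x. neg_log (1 - D x) * ennreal (mixture M w f x) \<partial>S"
  have A: "ext_expectation (density S (\<lambda>x. ennreal (P x))) (\<lambda>x. elog (D x)) = - enn2ereal ?A"
    using Dx by (subst ext_expectation_elog) (simp_all add: nn_integral_density mult.commute)
  have gen: "ext_expectation N (\<lambda>z. elog (1 - D (G m z)))
      = - enn2ereal (\<integral>\<^sup>+x. ennreal (f m x) * neg_log (1 - D x) \<partial>S)" if m: "m \<in> {1..M}" for m
  proof -
    note [measurable] = realizesD(3,4) [OF G m]
    have "(\<integral>\<^sup>+z. neg_log (1 - D (G m z)) \<partial>N) = (\<integral>\<^sup>+x. neg_log (1 - D x) \<partial>distr N S (G m))"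
      by (subst nn_integral_distr) auto
    also have "\<dots> = (\<integral>\<^sup>+x. ennreal (f m x) * neg_log (1 - D x) \<partial>S)"
      by (simp add: realizesD(2) [OF G m] nn_integral_density)
    finally show ?thesis
      using Dx(1) measurable_space [OF realizesD(3) [OF G m]] by (simp add: ext_expectation_elog)
  qed
  have B: "(\<Sum>m=1..M. ereal (w m) * ext_expectation N (\<lambda>z. elog (1 - D (G m z)))) = - enn2ereal ?B"
  proof -
    have "(\<Sum>m=1..M. ereal (w m) * ext_expectation N (\<lambda>z. elog (1 - D (G m z))))
        = (\<Sum>m=1..M. ereal (w m) * - enn2ereal (\<integral>\<^sup>+x. ennreal (f m x) * neg_log (1 - D x) \<partial>S))"
      by (intro sum.cong refl) (simp only: gen)
    also have "\<dots> = - enn2ereal (\<Sum>m=1..M. ennreal (w m) * (\<integral>\<^sup>+x. ennreal (f m x) * neg_log (1 - D x) \<partial>S))"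
      using w_nonneg by (rule sum_weighted_uminus_enn2ereal)
    also have "(\<Sum>m=1..M. ennreal (w m) * (\<integral>\<^sup>+x. ennreal (f m x) * neg_log (1 - D x) \<partial>S)) = ?B"
      using w_nonneg realizesD(1) [OF G] by (intro nn_integral_mixture [symmetric]) auto
    finally show ?thesis .
  qed
  have "(\<Sum>m=1..M. ereal (w m) * ext_expectation (distr N S (G m)) (\<lambda>x. elog (C m x)))
      = - enn2ereal (classifier_loss G C)"
  proof -
    have "ext_expectation (distr N S (G m)) (\<lambda>x. elog (C m x))
        = - enn2ereal (\<integral>\<^sup>+x. neg_log (C m x) \<partial>distr N S (G m))" if "m \<in> {1..M}" for m
      using classifier_le_1 [OF C that] by (intro ext_expectation_elog) simp
    then have "(\<Sum>m=1..M. ereal (w m) * ext_expectation (distr N S (G m)) (\<lambda>x. elog (C m x)))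
        = (\<Sum>m=1..M. ereal (w m) * - enn2ereal (\<integral>\<^sup>+x. neg_log (C m x) \<partial>distr N S (G m)))"
      by (intro sum.cong refl) (simp only:)
    also have "\<dots> = - enn2ereal (classifier_loss G C)"
      unfolding classifier_loss_def using w_nonneg by (rule sum_weighted_uminus_enn2ereal)
    finally show ?thesis .
  qed
  then have Y: "ereal lam * (\<Sum>m=1..M. ereal (w m) * ext_expectation (distr N S (G m)) (\<lambda>x. elog (C m x)))
      = - enn2ereal (ennreal lam * classifier_loss G C)"
    using lam_pos by (simp add: times_ennreal.rep_eq enn2ereal_ennreal)
  have loss: "discriminator_loss (mixture M w f) D = ?A + ?B"
    unfolding discriminator_loss_def by (rule nn_integral_add) measurable
  \<comment> \<open>If both losses are infinite, either side is infinity by the conventions of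
    \<open>ereal\<close>.\<close>
  have "- a + - b - - y = y - (a + b)" if "0 \<le> a" "0 \<le> b" "0 \<le> y" for a b y :: ereal
    using that by (cases a; cases b; cases y) auto
  then show ?thesis
    unfolding objective_def A B Y loss by (simp add: plus_ennreal.rep_eq)
qed

text \<open>The constant \<open>1 / 2\<close> costs \<open>ln 2\<close> on each of two unit masses,
  whatever \<open>Q\<close> is. This makes it the test discriminator for bounds on the inner
  maximum.\<close>

lemma discriminator_loss_half:
  assumes "prob_density S Q"
  shows "discriminator_loss Q (\<lambda>_. 1 / 2) = ennreal (2 * ln 2)"
proof -
  have [measurable]: "Q \<in> borel_measurable S"
    using assms by (auto simp: prob_density_def)
  have "discriminator_loss Q (\<lambda>_. 1 / 2) = ennreal (ln 2) * 2"
    using P assms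
    by (simp add: discriminator_loss_def neg_log_pos ln_div nn_integral_add nn_integral_cmult
        prob_density_def mult_2_right)
  then show ?thesis by (simp add: ennreal_mult mult.commute)
qed

text \<open>For \<open>Q = P\<close> the density factors out of the integrand, and
  \<open>neg_log_add_ge\<close> is integrated against mass one.\<close>

lemma discriminator_loss_ge:
  assumes Q: "AE x in S. Q x = P x" and D: "D \<in> discriminators S"
  shows "ennreal (2 * ln 2) \<le> discriminator_loss Q D"
proof -
  have "ennreal (2 * ln 2) = (\<integral>\<^sup>+x. ennreal (2 * ln 2) * ennreal (P x) \<partial>S)"
    using P by (subst nn_integral_cmult) (auto simp: prob_density_def)
  also have "\<dots> \<le> discriminator_loss Q D"
    unfolding discriminator_loss_def
  proof (rule nn_integral_mono_AE, rule AE_mp [OF Q], intro AE_I2 impI)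
    fix x assume "x \<in> space S" "Q x = P x"
    then show "ennreal (2 * ln 2) * ennreal (P x)
        \<le> neg_log (D x) * ennreal (P x) + neg_log (1 - D x) * ennreal (Q x)"
      using D neg_log_add_ge [of "D x"]
      by (auto simp: discriminators_def distrib_right [symmetric] intro!: mult_right_mono)
  qed
  finally show ?thesis .
qed

lemma half_discriminators: "(\<lambda>_. 1 / 2) \<in> discriminators S"
  by (simp add: discriminators_def)

lemma inner_max_optimal:
  assumes G: "realizes f G" and C: "C \<in> classifiers S M"
    and "AE x in S. mixture M w f x = P x" and "classifier_loss G C = 0"
  shows "inner_max S N M w lam P G C = ereal (- 2 * ln 2)"
    and "objective S N M w lam P G C (\<lambda>_. 1 / 2) = ereal (- 2 * ln 2)"
proof -
  show half: "objective S N M w lam P G C (\<lambda>_. 1 / 2) = ereal (- 2 * ln 2)"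
    using assms half_discriminators discriminator_loss_half [OF prob_density_realized [OF G]]
    by (simp add: objective_eq zero_ennreal.rep_eq enn2ereal_ennreal)
  have "objective S N M w lam P G C D \<le> ereal (- 2 * ln 2)" if D: "D \<in> discriminators S" for D
  proof -
    have "enn2ereal (ennreal (2 * ln 2)) \<le> enn2ereal (discriminator_loss (mixture M w f) D)"
      using discriminator_loss_ge [OF assms(3) D] by (simp add: less_eq_ennreal.rep_eq)
    then show ?thesis
      using assms(4)
      by (simp add: objective_eq [OF G C D] zero_ennreal.rep_eq enn2ereal_ennreal uminus_le_ereal_uminus_iff)
  qed
  then show "inner_max S N M w lam P G C = ereal (- 2 * ln 2)"
    unfolding inner_max_def using half half_discriminators
    by (intro antisym SUP_least) (auto intro: SUP_upper2)
qed

text \<open>The discriminator \<open>1 / 2\<close> leaves a nonnegative classifier term minus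
  \<open>2 * ln 2\<close>.\<close>

lemma inner_max_ge:
  assumes G: "realizes f G" and C: "C \<in> classifiers S M"
  shows "ereal (- 2 * ln 2) \<le> inner_max S N M w lam P G C"
proof -
  have "ereal (- 2 * ln 2) \<le> objective S N M w lam P G C (\<lambda>_. 1 / 2)"
  proof -
    have "ereal (- r) \<le> y - ereal r" if "0 \<le> y" for r y
      using that by (cases y) auto
    then show ?thesis
      using discriminator_loss_half [OF prob_density_realized [OF G]]
      by (simp add: objective_eq [OF G C half_discriminators] enn2ereal_ennreal)
  qed
  then show ?thesis
    unfolding inner_max_def using half_discriminators by (rule SUP_upper2 [rotated])
qed

text \<open>Converse of \<open>inner_max_optimal\<close>. Testing with \<open>1 / 2\<close>, whose
  loss is finite and cancels, forces the classifier loss to be zero. Then every discriminator has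
  loss at least \<open>2 * ln 2\<close>, as \<open>AE_eq_of_loss_ge\<close> requires.\<close>

lemma inner_max_leD:
  assumes G: "realizes f G" and C: "C \<in> classifiers S M"
    and le: "inner_max S N M w lam P G C \<le> ereal (- 2 * ln 2)"
  shows "classifier_loss G C = 0" and "AE x in S. mixture M w f x = P x"
proof -
  note Q = prob_density_realized [OF G]
  have obj: "enn2ereal (ennreal lam * classifier_loss G C) - enn2ereal (discriminator_loss (mixture M w f) D)
      \<le> ereal (- 2 * ln 2)" if "D \<in> discriminators S" for D
    using SUP_upper [OF that, of "objective S N M w lam P G C"] le
    by (simp add: objective_eq [OF G C that] inner_max_def)
  have "y \<le> 0" if "y - ereal r \<le> ereal (- r)" for r y
    using that by (cases y) auto
  from this [of _ "2 * ln 2"] have "enn2ereal (ennreal lam * classifier_loss G C) \<le> 0"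
    using obj [OF half_discriminators] discriminator_loss_half [OF Q] by (simp add: enn2ereal_ennreal)
  then have "ennreal lam * classifier_loss G C = 0"
    by (metis zero_ennreal.rep_eq less_eq_ennreal.rep_eq le_zero_eq)
  then show loss: "classifier_loss G C = 0"
    using lam_pos by (simp add: ennreal_eq_0_iff)
  have "ennreal (2 * ln 2) \<le> discriminator_loss (mixture M w f) D" if "D \<in> discriminators S" for D
    using obj [OF that] loss
    by (simp add: less_eq_ennreal.rep_eq enn2ereal_ennreal zero_ennreal.rep_eq uminus_le_ereal_uminus_iff)
  then show "AE x in S. mixture M w f x = P x"
    unfolding discriminator_loss_def by (rule AE_eq_of_loss_ge [OF P Q])
qed

section \<open>Vanishing classifier loss, and passage to \<open>gen_density\<close>\<close>

lemma classifier_loss_eq_0_iff: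
  assumes "C \<in> classifiers S M"
  shows "classifier_loss G C = 0 \<longleftrightarrow> (\<forall>m\<in>{1..M}. w m > 0 \<longrightarrow> (AE x in distr N S (G m). C m x = 1))"
proof -
  have summand: "ennreal (w m) * (\<integral>\<^sup>+x. neg_log (C m x) \<partial>distr N S (G m)) = 0
      \<longleftrightarrow> (w m > 0 \<longrightarrow> (AE x in distr N S (G m). C m x = 1))"
    if m: "m \<in> {1..M}" for m
  proof -
    have [measurable]: "C m \<in> borel_measurable S"
      using assms m by (simp add: classifiers_def)
    \<comment> \<open>A vanishing \<open>neg_log\<close> only says \<open>1 \<le> C m x\<close>;
      equality comes from \<open>classifier_le_1\<close>.\<close>
    have "(AE x in distr N S (G m). neg_log (C m x) = 0) \<longleftrightarrow> (AE x in distr N S (G m). C m x = 1)"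
      using classifier_le_1 [OF assms m] by (intro AE_cong) (force simp: neg_log_eq_0_iff)
    then have "(\<integral>\<^sup>+x. neg_log (C m x) \<partial>distr N S (G m)) = 0
        \<longleftrightarrow> (AE x in distr N S (G m). C m x = 1)"
      by (subst nn_integral_0_iff_AE) auto
    then show ?thesis
      by (auto simp: ennreal_eq_0_iff)
  qed
  have "classifier_loss G C = 0
      \<longleftrightarrow> (\<forall>m\<in>{1..M}. ennreal (w m) * (\<integral>\<^sup>+x. neg_log (C m x) \<partial>distr N S (G m)) = 0)"
    unfolding classifier_loss_def by (rule sum_nonneg_eq_0_iff) simp_all
  also have "\<dots> \<longleftrightarrow> (\<forall>m\<in>{1..M}. w m > 0 \<longrightarrow> (AE x in distr N S (G m). C m x = 1))"
    by (intro ball_cong refl summand)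
  finally show ?thesis .
qed

lemma gen_density_realized:
  assumes "realizes f G" "m \<in> {1..M}"
  shows "AE x in S. gen_density S N (G m) x = f m x"
  using assms unfolding realizes_def
  by (intro sigma_finite_measure.gen_density_eq [OF sigma_finite_S]) auto

lemma model_density_realized:
  assumes G: "realizes f G" and f: "AE x in S. mixture M w f x = P x"
  shows "AE x in S. model_density S N M w G x = P x"
proof -
  have "AE x in S. \<forall>m\<in>{1..M}. gen_density S N (G m) x = f m x"
    using gen_density_realized [OF G] by (intro AE_finite_allI) auto
  then show ?thesis
    using f
  proof eventually_elim
    case (elim x)
    then show ?case by (simp add: model_density_def mixture_def)
  qed
qed

end

section \<open>Separated real data and an explicit equilibrium\<close>

text \<open>\<open>arbitrary_densities\<close> expresses the non-parametric setting: it provides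
  generators realizing \<open>p\<close>, so that the value \<open>- 2 * ln 2\<close> is
  attained.\<close>

locale separated_gan_game = gan_game +
  fixes p :: "nat \<Rightarrow> 'a \<Rightarrow> real"
  assumes M_pos: "M \<ge> 1"
    and separated: "separated_mixture S M w P p"
    and arbitrary_densities:
      "\<And>f. prob_density S f \<Longrightarrow> \<exists>g. distributed N S g (\<lambda>x. ennreal (f x))"
begin

lemma p_prob_density: "m \<in> {1..M} \<Longrightarrow> prob_density S (p m)"
  and p_mixture: "AE x in S. P x = mixture M w p x"
  using separated by (auto simp: separated_mixture_def mixture_def)

lemma p_separated:
  assumes "x \<in> space S" "m \<in> {1..M}" "m' \<in> {1..M}" "m' \<noteq> m" "p m x > 0"
  shows "p m' x = 0"
  using separated assms unfolding separated_mixture_def by blast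

lemma p_nonneg: "m \<in> {1..M} \<Longrightarrow> x \<in> space S \<Longrightarrow> 0 \<le> p m x"
  and p_measurable: "m \<in> {1..M} \<Longrightarrow> p m \<in> borel_measurable S"
  using p_prob_density by (auto simp: prob_density_def)

lemma ex_p_realized: "\<exists>G. realizes p G"
proof -
  have "\<forall>m\<in>{1..M}. \<exists>g. distributed N S g (\<lambda>x. ennreal (p m x))"
    using arbitrary_densities p_prob_density by blast
  from bchoice [OF this] obtain G where "\<forall>m\<in>{1..M}. distributed N S (G m) (\<lambda>x. ennreal (p m x))"
    by blast
  then have "realizes p G"
    using p_prob_density by (simp add: realizes_def)
  then show ?thesis by blast
qed

text \<open>Points outside all supports are assigned to the first generator, since the components of a
  classifier have to sum to one everywhere.\<close>

definition support_classifier :: "nat \<Rightarrow> 'a \<Rightarrow> real" where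
  "support_classifier m x = of_bool (p m x > 0 \<or> m = 1 \<and> (\<forall>m'\<in>{1..M}. \<not> p m' x > 0))"

lemma support_classifier_mem: "support_classifier \<in> classifiers S M"
proof -
  have "support_classifier m \<in> borel_measurable S" if "m \<in> {1..M}" for m
  proof -
    note [measurable] = p_measurable
    have [measurable]: "Measurable.pred S (\<lambda>x. \<forall>m'\<in>{1..M}. \<not> p m' x > 0)"
      by (intro pred_intros_finite) (auto intro: p_measurable)
    show ?thesis
      unfolding support_classifier_def using that by measurable
  qed
  moreover have "(\<Sum>m=1..M. support_classifier m x) = 1" if x: "x \<in> space S" for x
  proof -
    \<comment> \<open>At each point the classifier is the indicator of one index: the unique
      positive component, or \<open>1\<close> if there is none.\<close>
    have "\<exists>i\<in>{1..M}. \<forall>m\<in>{1..M}. support_classifier m x = of_bool (m = i)"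
    proof (cases "\<exists>i\<in>{1..M}. p i x > 0")
      case True
      then obtain i where i: "i \<in> {1..M}" "p i x > 0" by blast
      then have "\<forall>m\<in>{1..M}. support_classifier m x = of_bool (m = i)"
        using p_separated [OF x i(1)] by (fastforce simp: support_classifier_def)
      with i show ?thesis by blast
    next
      case False
      then have "\<forall>m\<in>{1..M}. support_classifier m x = of_bool (m = 1)"
        by (auto simp: support_classifier_def)
      with M_pos show ?thesis by force
    qed
    then obtain i where i: "i \<in> {1..M}" "\<forall>m\<in>{1..M}. support_classifier m x = of_bool (m = i)"
      by blast
    then have "(\<Sum>m=1..M. support_classifier m x) = (\<Sum>m=1..M. of_bool (m = i))"
      by (intro sum.cong) auto
    then show ?thesis
      using i(1) by (simp add: of_bool_def)
  qed
  ultimately show ?thesis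
    by (auto simp: classifiers_def support_classifier_def)
qed

lemma support_classifier_AE:
  assumes G: "realizes p G" and m: "m \<in> {1..M}"
  shows "AE x in distr N S (G m). support_classifier m x = 1"
    and "m' \<in> {1..M} \<Longrightarrow> m' \<noteq> m \<Longrightarrow> AE x in distr N S (G m). support_classifier m' x = 0"
proof -
  have one: "p m x > 0 \<longrightarrow> support_classifier m x = 1" for x
    by (simp add: support_classifier_def)
  then show "AE x in distr N S (G m). support_classifier m x = 1"
    by (simp add: AE_realized_iff [OF G m])
  assume "m' \<in> {1..M}" "m' \<noteq> m"
  then show "AE x in distr N S (G m). support_classifier m' x = 0"
    unfolding AE_realized_iff [OF G m]
    using one classifier_other_eq_0 [OF support_classifier_mem m] by (intro AE_I2) blast
qed

lemma p_mixture': "AE x in S. mixture M w p x = P x"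
  using p_mixture by (auto elim: eventually_mono)

lemma support_classifier_loss: "realizes p G \<Longrightarrow> classifier_loss G support_classifier = 0"
  by (simp add: classifier_loss_eq_0_iff support_classifier_mem support_classifier_AE)

text \<open>The value equals the lower bound \<open>inner_max_ge\<close>, which holds for all
  competitors.\<close>

lemma equilibrium_support:
  assumes G: "realizes p G"
  shows "equilibrium S N M w lam P G support_classifier (\<lambda>_. 1 / 2)"
proof -
  note opt = inner_max_optimal [OF G support_classifier_mem p_mixture' support_classifier_loss [OF G]]
  have "ereal (- 2 * ln 2) \<le> inner_max S N M w lam P G' C'"
    if "G' \<in> generators S N M" "C' \<in> classifiers S M" for G' C'
    using that inner_max_ge by (auto simp: generators_realizes)
  moreover have "G \<in> generators S N M"
    using G by (auto simp: generators_realizes)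
  ultimately show ?thesis
    using half_discriminators support_classifier_mem
    unfolding equilibrium_def opt by blast
qed

section \<open>Properties of every equilibrium\<close>

text \<open>An equilibrium is no worse than the competitor built from \<open>p\<close> and
  \<open>support_classifier\<close>, whose value is \<open>- 2 * ln 2\<close>;
  \<open>inner_max_leD\<close> extracts the rest.\<close>

lemma equilibriumD:
  assumes eq: "equilibrium S N M w lam P G C D" and G: "realizes f G"
  shows "C \<in> classifiers S M"
    and "\<And>m. m \<in> {1..M} \<Longrightarrow> w m > 0 \<Longrightarrow> AE x in distr N S (G m). C m x = 1"
    and "AE x in S. mixture M w f x = P x"
proof -
  show C: "C \<in> classifiers S M"
    using eq by (simp add: equilibrium_def)
  obtain G' where G': "realizes p G'"
    using ex_p_realized by blast
  then have "G' \<in> generators S N M"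
    by (auto simp: generators_realizes)
  then have "inner_max S N M w lam P G C \<le> inner_max S N M w lam P G' support_classifier"
    using eq support_classifier_mem unfolding equilibrium_def by blast
  then have "inner_max S N M w lam P G C \<le> ereal (- 2 * ln 2)"
    using inner_max_optimal(1) [OF G' support_classifier_mem p_mixture' support_classifier_loss [OF G']]
    by simp
  note * = inner_max_leD [OF G C this]
  show "AE x in distr N S (G m). C m x = 1" if "m \<in> {1..M}" "w m > 0" for m
    using *(1) that by (simp add: classifier_loss_eq_0_iff [OF C])
  show "AE x in S. mixture M w f x = P x"
    by (rule *(2))
qed

lemma equilibrium_other_eq_0:
  assumes eq: "equilibrium S N M w lam P G C D" and G: "realizes f G"
    and m: "m \<in> {1..M}" "m' \<in> {1..M}" "m' \<noteq> m" "w m' > 0"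
  shows "AE x in distr N S (G m'). C m x = 0"
  using equilibriumD(2) [OF eq G m(2,4)]
proof (rule AE_mp, intro AE_I2 impI)
  fix x assume "x \<in> space (distr N S (G m'))" "C m' x = 1"
  then show "C m x = 0"
    using classifier_other_eq_0 [OF equilibriumD(1) [OF eq G] m(2,1)] m(3) by simp
qed

text \<open>Modifying the equilibrium densities on a null set makes their supports disjoint everywhere.
  Components of weight zero are unconstrained by the equilibrium; there \<open>p m\<close> itself serves, its
  support being disjoint from that of the real data.\<close>

lemma equilibrium_separated:
  assumes eq: "equilibrium S N M w lam P G C D" and G: "realizes f G"
  shows "\<exists>q. separated_mixture S M w P q \<and>
    (\<forall>m\<in>{1..M}. w m > 0 \<longrightarrow> (AE x in S. f m x = q m x))"
proof -
  \<comment> \<open>The support of the real data is described through \<open>p\<close> because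
    \<open>p\<close> is separated at every point, while \<open>P\<close> agrees with the mixture
    only almost everywhere.\<close>
  define A where "A x \<longleftrightarrow> (\<exists>m\<in>{1..M}. w m > 0 \<and> p m x > 0)" for x
  \<comment> \<open>\<open>C m x = 1\<close> separates components of positive weight from each
    other, \<open>A x\<close> separates them from those of weight zero.\<close>
  define q where "q m x = (if w m > 0 then f m x * of_bool (C m x = 1 \<and> A x) else p m x)" for m x
  note C = equilibriumD(1) [OF eq G]
  have [measurable]: "Measurable.pred S A"
  proof -
    note [measurable] = p_measurable
    show ?thesis
      unfolding A_def by (intro pred_intros_finite) auto
  qed
  \<comment> \<open>The cut removes only a null set: where \<open>f m\<close> is positive, almost
    surely \<open>C m\<close> is one, and the mixture of \<open>f\<close>, hence that of
    \<open>p\<close>, is positive.\<close>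
  have q_AE: "AE x in S. f m x = q m x" if m: "m \<in> {1..M}" "w m > 0" for m
  proof -
    have "AE x in S. f m x > 0 \<longrightarrow> C m x = 1"
      using equilibriumD(2) [OF eq G m] by (simp add: AE_realized_iff [OF G m(1)])
    then show ?thesis
      using equilibriumD(3) [OF eq G] p_mixture AE_space
    proof eventually_elim
      case (elim x)
      note f_nn = realizesD(5) [OF G _ elim(4)]
      show ?case
      proof (cases "f m x > 0")
        case True
        then have "mixture M w f x > 0"
          using m f_nn by (subst mixture_pos_iff) auto
        then have "mixture M w p x > 0"
          using elim by simp
        then have "A x"
          unfolding A_def using p_nonneg [OF _ elim(4)] by (subst (asm) mixture_pos_iff)
        then show ?thesis using True elim m by (simp add: q_def)
      next
        case False
        then have "f m x = 0" using f_nn [OF m(1)] by simp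
        then show ?thesis using m by (simp add: q_def)
      qed
    qed
  qed
  have "prob_density S (q m)" if m: "m \<in> {1..M}" for m
  proof (cases "w m > 0")
    case True
    have [measurable]: "C m \<in> borel_measurable S" "f m \<in> borel_measurable S"
      using C m realizesD(4) [OF G m] by (auto simp: classifiers_def)
    have "q m \<in> borel_measurable S"
      using True unfolding q_def by simp
    moreover have "(\<integral>\<^sup>+x. ennreal (q m x) \<partial>S) = (\<integral>\<^sup>+x. ennreal (f m x) \<partial>S)"
      using q_AE [OF m True] by (intro nn_integral_cong_AE) auto
    ultimately show ?thesis
      using realizesD(1) [OF G m] True by (auto simp: prob_density_def q_def)
  next
    case False
    then have "q m = p m" by (auto simp: q_def)
    then show ?thesis using p_prob_density [OF m] by simp
  qed
  moreover have "AE x in S. P x = (\<Sum>m=1..M. w m * q m x)"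
  proof -
    have "AE x in S. \<forall>m\<in>{m \<in> {1..M}. w m > 0}. f m x = q m x"
      using q_AE by (intro AE_finite_allI) auto
    then show ?thesis
      using equilibriumD(3) [OF eq G]
    proof eventually_elim
      case (elim x)
      then have "mixture M w f x = mixture M w q x"
        by (intro mixture_cong) auto
      with elim show ?case by (simp add: mixture_def)
    qed
  qed
  moreover have "q m' x = 0"
    if x: "x \<in> space S" and m: "m \<in> {1..M}" "m' \<in> {1..M}" "m' \<noteq> m" and pos: "q m x > 0" for x m m'
  proof (rule ccontr)
    assume nz: "q m' x \<noteq> 0"
    consider "w m > 0" "w m' > 0" | "w m > 0" "\<not> w m' > 0" | "\<not> w m > 0" "w m' > 0"
      | "\<not> w m > 0" "\<not> w m' > 0" by blast
    then show False
    proof cases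
      case 1
      then have "C m x = 1" "C m' x = 1"
        using nz pos by (cases "C m x = 1"; cases "C m' x = 1"; simp add: q_def)+
      then show False using classifier_other_eq_0 [OF C m x] by simp
    next
      case 2
      then have "A x" "p m' x \<noteq> 0"
        using pos nz unfolding q_def by (simp_all add: of_bool_def split: if_splits)
      \<comment> \<open>Of \<open>i\<close> and \<open>m'\<close> only \<open>i\<close> has positive
        weight, so they differ and separation of \<open>p\<close> gives
        \<open>p m' x = 0\<close>.\<close>
      then obtain i where "i \<in> {1..M}" "w i > 0" "p i x > 0"
        unfolding A_def by blast
      then show False
        using 2 \<open>p m' x \<noteq> 0\<close> p_separated [OF x, of i m'] m(2) by blast
    next
      case 3
      then have "A x" "p m x \<noteq> 0"
        using pos nz unfolding q_def by (simp_all add: of_bool_def split: if_splits)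
      then obtain i where "i \<in> {1..M}" "w i > 0" "p i x > 0"
        unfolding A_def by blast
      then show False
        using 3 \<open>p m x \<noteq> 0\<close> p_separated [OF x, of i m] m(1) by blast
    next
      case 4
      then show False
        using nz pos p_separated [OF x m] by (simp add: q_def)
    qed
  qed
  ultimately have "separated_mixture S M w P q"
    unfolding separated_mixture_def by (intro conjI ballI impI)
  moreover have "\<forall>m\<in>{1..M}. w m > 0 \<longrightarrow> (AE x in S. f m x = q m x)"
    using q_AE by (intro ballI impI)
  ultimately show ?thesis by (intro exI [of _ q] conjI)
qed

text \<open>\<open>p1\<close> says that the classifier labels the components of \<open>p\<close>
  correctly. Almost everywhere, where \<open>C m\<close> is one, all other components of positive
  weight vanish in both mixtures, so their equality reduces to that of the \<open>m\<close>-th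
  terms; elsewhere \<open>f m\<close> and \<open>p m\<close> are both zero.\<close>

lemma equilibrium_recovers:
  assumes eq: "equilibrium S N M w lam P G C D" and G: "realizes f G"
    and p1: "\<And>m. m \<in> {1..M} \<Longrightarrow> w m > 0 \<Longrightarrow> AE x in density S (\<lambda>x. ennreal (p m x)). C m x = 1"
    and m: "m \<in> {1..M}" "w m > 0"
  shows "AE x in S. f m x = p m x"
proof -
  have "AE x in S. \<forall>i\<in>{i \<in> {1..M}. w i > 0}. (f i x > 0 \<longrightarrow> C i x = 1) \<and> (p i x > 0 \<longrightarrow> C i x = 1)"
  proof (rule AE_finite_allI)
    fix i assume i: "i \<in> {i \<in> {1..M}. w i > 0}"
    then have "AE x in S. f i x > 0 \<longrightarrow> C i x = 1"
      using equilibriumD(2) [OF eq G, of i] by (simp add: AE_realized_iff [OF G])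
    moreover have "AE x in S. p i x > 0 \<longrightarrow> C i x = 1"
      using p1 [of i] i p_measurable [of i] by (simp add: AE_density)
    ultimately show "AE x in S. (f i x > 0 \<longrightarrow> C i x = 1) \<and> (p i x > 0 \<longrightarrow> C i x = 1)"
      by eventually_elim simp
  qed simp
  then show ?thesis
    using equilibriumD(3) [OF eq G] p_mixture AE_space
  proof eventually_elim
    case (elim x)
    note nn = realizesD(5) [OF G _ elim(4)] p_nonneg [OF _ elim(4)]
    show ?case
    proof (cases "C m x = 1")
      case True
      have "f i x = 0 \<and> p i x = 0" if i: "i \<in> {1..M}" "i \<noteq> m" "w i > 0" for i
        using classifier_other_eq_0 [OF equilibriumD(1) [OF eq G] m(1) i(1,2) elim(4) True]
          elim(1) i nn [OF i(1)] by force
      then have "mixture M w f x = w m * f m x" "mixture M w p x = w m * p m x"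
        using m(1) by (auto intro!: mixture_single)
      then show ?thesis using elim m by simp
    next
      case False
      then have "\<not> f m x > 0" "\<not> p m x > 0" using elim(1) m by auto
      then show ?thesis using nn [OF m(1)] by simp
    qed
  qed
qed

end

text \<open>Equilibria determine the components only up to the choice of decomposition: every
  separated decomposition of \<open>P\<close> with weights \<open>w\<close> yields one, for instance
  \<open>p\<close> with two components of equal weight swapped. So (b) appears in three forms: the
  densities belong to some such decomposition \<open>q\<close>, they are those of \<open>p\<close>
  if the classifier labels \<open>p\<close> correctly, and an equilibrium with exactly
  \<open>p\<close> exists. Components of weight zero do not enter the objective, hence the
  restriction to \<open>w m > 0\<close> for arbitrary equilibria.\<close>

theorem theorem1:
  fixes S :: "'x measure" and N :: "'z measure" and M :: nat
    and w :: "nat \<Rightarrow> real" and lam :: real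
    and P :: "'x \<Rightarrow> real" and p :: "nat \<Rightarrow> 'x \<Rightarrow> real"
  assumes "sigma_finite_measure S" and "prob_space N"
    and arbitrary_densities:
      "\<And>f. prob_density S f \<Longrightarrow> \<exists>g. distributed N S g (\<lambda>x. ennreal (f x))"
    and "M \<ge> 1" and "lam > 0"
    and "\<And>m. m \<in> {1..M} \<Longrightarrow> w m \<ge> 0" and "(\<Sum>m=1..M. w m) = 1"
    and "prob_density S P"
    and "separated_mixture S M w P p"
  shows
    "(\<forall>G C D. equilibrium S N M w lam P G C D \<longrightarrow>
        (\<forall>m\<in>{1..M}.
           (w m > 0 \<longrightarrow> (AE x in distr N S (G m). C m x = 1)) \<and>
           (\<forall>m'\<in>{1..M}. m' \<noteq> m \<and> w m' > 0 \<longrightarrow> (AE x in distr N S (G m'). C m x = 0))) \<and>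
        (\<exists>q. separated_mixture S M w P q \<and>
           (\<forall>m\<in>{1..M}. w m > 0 \<longrightarrow> (AE x in S. gen_density S N (G m) x = q m x))) \<and>
        ((\<forall>m\<in>{1..M}. w m > 0 \<longrightarrow>
             (AE x in density S (\<lambda>x. ennreal (p m x)). C m x = 1)) \<longrightarrow>
           (\<forall>m\<in>{1..M}. w m > 0 \<longrightarrow> (AE x in S. gen_density S N (G m) x = p m x))) \<and>
        (AE x in S. model_density S N M w G x = P x))
     \<and>
     (\<exists>G C D. equilibrium S N M w lam P G C D \<and>
        (\<forall>m\<in>{1..M}.
           (AE x in distr N S (G m). C m x = 1) \<and>
           (\<forall>m'\<in>{1..M}. m' \<noteq> m \<longrightarrow> (AE x in distr N S (G m'). C m x = 0))) \<and>
        (\<forall>m\<in>{1..M}. AE x in S. gen_density S N (G m) x = p m x) \<and>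
        (AE x in S. model_density S N M w G x = P x))"
proof -
  interpret separated_gan_game S N M w lam P p
    using assms
    by (intro separated_gan_game.intro gan_game.intro separated_gan_game_axioms.intro)
  show ?thesis
  proof (intro conjI allI impI)
    fix G C D assume eq: "equilibrium S N M w lam P G C D"
    then obtain f where G: "realizes f G"
      by (auto simp: equilibrium_def generators_realizes)
    show "\<forall>m\<in>{1..M}.
        (w m > 0 \<longrightarrow> (AE x in distr N S (G m). C m x = 1)) \<and>
        (\<forall>m'\<in>{1..M}. m' \<noteq> m \<and> w m' > 0 \<longrightarrow> (AE x in distr N S (G m'). C m x = 0))"
      using equilibriumD(2) [OF eq G] equilibrium_other_eq_0 [OF eq G] by blast
    have trans: "AE x in S. gen_density S N (G m) x = g x"
      if "m \<in> {1..M}" "AE x in S. f m x = g x" for m g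
      using gen_density_realized [OF G that(1)] that(2) by eventually_elim simp
    obtain q where "separated_mixture S M w P q"
        "\<forall>m\<in>{1..M}. w m > 0 \<longrightarrow> (AE x in S. f m x = q m x)"
      using equilibrium_separated [OF eq G] by blast
    then show "\<exists>q. separated_mixture S M w P q \<and>
        (\<forall>m\<in>{1..M}. w m > 0 \<longrightarrow> (AE x in S. gen_density S N (G m) x = q m x))"
      using trans by blast
    show "\<forall>m\<in>{1..M}. w m > 0 \<longrightarrow> (AE x in S. gen_density S N (G m) x = p m x)"
      if "\<forall>m\<in>{1..M}. w m > 0 \<longrightarrow> (AE x in density S (\<lambda>x. ennreal (p m x)). C m x = 1)"
      using trans equilibrium_recovers [OF eq G] that by blast
    show "AE x in S. model_density S N M w G x = P x"
      using model_density_realized [OF G equilibriumD(3) [OF eq G]] .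
  next
    obtain G where G: "realizes p G"
      using ex_p_realized by blast
    have "\<forall>m\<in>{1..M}.
        (AE x in distr N S (G m). support_classifier m x = 1) \<and>
        (\<forall>m'\<in>{1..M}. m' \<noteq> m \<longrightarrow> (AE x in distr N S (G m'). support_classifier m x = 0))"
      using support_classifier_AE [OF G] by blast
    moreover have "\<forall>m\<in>{1..M}. AE x in S. gen_density S N (G m) x = p m x"
      using gen_density_realized [OF G] by blast
    ultimately show "\<exists>G C D. equilibrium S N M w lam P G C D \<and>
        (\<forall>m\<in>{1..M}.
           (AE x in distr N S (G m). C m x = 1) \<and>
           (\<forall>m'\<in>{1..M}. m' \<noteq> m \<longrightarrow> (AE x in distr N S (G m'). C m x = 0))) \<and>
        (\<forall>m\<in>{1..M}. AE x in S. gen_density S N (G m) x = p m x) \<and>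
        (AE x in S. model_density S N M w G x = P x)"
      using equilibrium_support [OF G] model_density_realized [OF G p_mixture'] by blast
  qed
qed

end
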